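(* Let $0<\alpha<\pi/2$ and let $F\in PW_\alpha$. Assume that for every $k\in\mathbb N$ there exists a constant $c_k$ such that $|F(m,0)|\leqslant c_k(1+|m|)^{-k}$ for every $m\in\mathbb Z$. Then $$\sum_{m\in\mathbb Z}|F(m,n)|<+\infty$$ for every $n\in\mathbb Z$.
   Context: A function $F:\mathbb Z^2\to\mathbb C$ is (discrete) entire if $F(m+1,n+1)-F(m,n)=-i\big(F(m,n+1)-F(m+1,n)\big)$ for every $(m,n)\in\mathbb Z^2$. For $t\in[-\pi,\pi)$, $t\neq\pm\pi/2$, the discrete exponential is $e_t:\mathbb Z^2\to\mathbb C$, $e_t(m,n)=e^{itm}\Big(\frac{1+ie^{it}}{i+e^{it}}\Big)^n$. The space $PW_\alpha$ is the set of all entire $F:\mathbb Z^2\to\mathbb C$ such that (i) there exists $c>0$ with $|F(m,n)|\leqslant c\,|e_{-\alpha}(0,1)|^{|n|}$ for every $(m,n)\in\mathbb Z^2$, and (ii) $\sum_{m\in\mathbb Z}|F(m,0)|^2<+\infty$. *)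

theory Defs
  imports "HOL-Analysis.Analysis"
begin

definition discrete_entire :: "(int \<times> int \<Rightarrow> complex) \<Rightarrow> bool" where
  "discrete_entire F \<longleftrightarrow>
     (\<forall>m n. F (m + 1, n + 1) - F (m, n) = - \<i> * (F (m, n + 1) - F (m + 1, n)))"

text \<open>
  Meaningful for \<open>- pi \<le> t < pi\<close> with \<open>t \<noteq> pi/2\<close> and \<open>t \<noteq> - pi/2\<close>: exactly at the two excluded
  values the numerator or the denominator of the base vanishes.
\<close>

definition discrete_exp :: "real \<Rightarrow> int \<times> int \<Rightarrow> complex" where
  "discrete_exp t = (\<lambda>(m, n).
     exp (\<i> * of_real t * of_int m) *
     ((1 + \<i> * exp (\<i> * of_real t)) / (\<i> + exp (\<i> * of_real t))) powi n)"

text \<open>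
  Finiteness of a series of nonnegative terms over the integers is expressed by \<open>summable_on\<close>.
\<close>

definition PW :: "real \<Rightarrow> (int \<times> int \<Rightarrow> complex) set" where
  "PW \<alpha> = {F. discrete_entire F \<and>
     (\<exists>c>0. \<forall>m n. norm (F (m, n)) \<le> c * norm (discrete_exp (- \<alpha>) (0, 1)) powi \<bar>n\<bar>) \<and>
     (\<lambda>m. (norm (F (m, 0)))\<^sup>2) summable_on UNIV}"

end

theory Submission
  imports Defs
begin

text \<open>
  On rows, entirety is the recurrence \<open>F (m + 1, n + 1) + \<i> F (m, n + 1) = F (m, n) + \<i> F (m + 1, n)\<close>,
  and after the gauge change \<open>u m = \<i> ^ m * F (m, n + 1)\<close> it says that the increments of \<open>u\<close> are, up
  to a unimodular factor, the right-hand side. If row \<open>n\<close> decreases rapidly, so do these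
  increments, hence \<open>u\<close> converges rapidly to some limit \<open>L\<close> as \<open>m\<close> tends to infinity. So row \<open>n + 1\<close>
  is rapidly decreasing up to the term \<open>L * (- \<i>) ^ m\<close>, which solves the homogeneous recurrence and
  which row \<open>n\<close> alone cannot exclude. Row \<open>n + 2\<close> excludes it, by resonance: the gauged row \<open>n + 2\<close> has increments tending to
  \<open>2 * \<i> * L\<close>, so it can be bounded in \<open>m\<close> only if \<open>L = 0\<close> (\<open>bounded_increments_limit_eq_0\<close>).
  Thus rapid decrease passes from one row to the next (\<open>rapid_next_row\<close>), and by induction to all
  rows above row \<open>0\<close>.

  This takes care of \<open>m \<ge> 0\<close> and \<open>n \<ge> 0\<close>. Entirety is invariant under the point reflection
  \<open>F (- m, - n)\<close> and under \<open>cnj (F (- m, n))\<close>, so the other three quadrants reduce to this one.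
  The growth condition enters through the boundedness of each row.
\<close>

definition rapid :: "(nat \<Rightarrow> complex) \<Rightarrow> bool" where
  "rapid f \<longleftrightarrow> (\<forall>k. \<exists>c. \<forall>m. (1 + real m) ^ k * norm (f m) \<le> c)"

lemma rapid_imp_weighted_summable:
  assumes "rapid f"
  shows "summable (\<lambda>m. (1 + real m) ^ k * norm (f m))"
proof -
  \<comment> \<open>Two powers of the weight are spent on comparison with the series of inverse squares.\<close>
  obtain c where c: "\<And>m. (1 + real m) ^ (k + 2) * norm (f m) \<le> c"
    using assms unfolding rapid_def by blast
  have "summable (\<lambda>m. inverse (real (Suc m) ^ 2))"
    using inverse_power_summable[of 2, where 'a = real] by (subst summable_Suc_iff) simp
  then have "summable (\<lambda>m. c * inverse (real (Suc m) ^ 2))"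
    by (rule summable_mult)
  then show ?thesis
  proof (rule summable_comparison_test')
    fix m :: nat
    show "norm ((1 + real m) ^ k * norm (f m)) \<le> c * inverse (real (Suc m) ^ 2)"
      using c[of m] by (simp add: divide_simps power_add power2_eq_square ac_simps)
  qed
qed

lemma rapid_step:
  assumes "rapid f"
  shows "rapid (\<lambda>m. f m + \<i> * f (Suc m))"
  unfolding rapid_def
proof
  fix k
  obtain c where c: "\<And>m. (1 + real m) ^ k * norm (f m) \<le> c"
    using assms unfolding rapid_def by blast
  show "\<exists>c. \<forall>m. (1 + real m) ^ k * norm (f m + \<i> * f (Suc m)) \<le> c"
  proof (intro exI[of _ "c + c"] allI)
    fix m
    have "norm (f m + \<i> * f (Suc m)) \<le> norm (f m) + norm (f (Suc m))"
      by (rule norm_triangle_le) (simp add: norm_mult)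
    then have "(1 + real m) ^ k * norm (f m + \<i> * f (Suc m))
        \<le> (1 + real m) ^ k * norm (f m) + (1 + real m) ^ k * norm (f (Suc m))"
      by (simp flip: distrib_left add: mult_left_mono)
    also have "(1 + real m) ^ k * norm (f (Suc m)) \<le> (1 + real (Suc m)) ^ k * norm (f (Suc m))"
      by (intro mult_right_mono power_mono) auto
    finally show "(1 + real m) ^ k * norm (f m + \<i> * f (Suc m)) \<le> c + c"
      using c[of m] c[of "Suc m"] by linarith
  qed
qed

lemma rapid_increments_imp_convergent:
  assumes "rapid (\<lambda>m. u (Suc m) - u m)"
  shows "convergent u"
proof -
  have "summable (\<lambda>m. u (Suc m) - u m)"
    using rapid_imp_weighted_summable[OF assms, of 0] by (auto intro: summable_norm_cancel)
  then have "convergent (\<lambda>m. \<Sum>j<m. u (Suc j) - u j)"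
    by (simp add: summable_iff_convergent)
  then have "convergent (\<lambda>m. u m - u 0)"
    by (simp add: sum_lessThan_telescope)
  then show ?thesis
    by (simp add: convergent_diff_const_right_iff)
qed

text \<open>
  A sequence tending to \<open>0\<close> is minus the sum of its later increments, and on that tail the weight
  \<open>(1 + m) ^ k\<close> is dominated by \<open>(1 + j) ^ k\<close>, so the weighted sum of all increments bounds it.
\<close>

lemma rapid_if_rapid_increments:
  assumes d: "rapid (\<lambda>m. u (Suc m) - u m)" and lim: "u \<longlonglongrightarrow> 0"
  shows "rapid u"
  unfolding rapid_def
proof
  fix k
  define w where "w = (\<lambda>j. (1 + real j) ^ k * norm (u (Suc j) - u j))"
  have w: "summable w"
    unfolding w_def by (rule rapid_imp_weighted_summable[OF d])
  show "\<exists>c. \<forall>m. (1 + real m) ^ k * norm (u m) \<le> c"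
  proof (intro exI[of _ "suminf w"] allI)
    fix m
    have "(1 + real m) ^ k * norm (u N - u m) \<le> suminf w" if "m \<le> N" for N
    proof -
      have "norm (u N - u m) \<le> (\<Sum>j = m..<N. norm (u (Suc j) - u j))"
        using norm_sum[of "\<lambda>j. u (Suc j) - u j" "{m..<N}"] sum_Suc_diff'[OF that, of u] by simp
      then have "(1 + real m) ^ k * norm (u N - u m)
          \<le> (\<Sum>j = m..<N. (1 + real m) ^ k * norm (u (Suc j) - u j))"
        by (simp flip: sum_distrib_left add: mult_left_mono)
      also have "\<dots> \<le> sum w {m..<N}"
        unfolding w_def by (intro sum_mono mult_right_mono power_mono) auto
      also have "\<dots> \<le> suminf w"
        by (rule sum_le_suminf[OF w]) (auto simp: w_def)
      finally show ?thesis .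
    qed
    moreover have "(\<lambda>N. (1 + real m) ^ k * norm (u N - u m)) \<longlonglongrightarrow> (1 + real m) ^ k * norm (0 - u m)"
      by (intro tendsto_intros lim)
    ultimately have "(1 + real m) ^ k * norm (0 - u m) \<le> suminf w"
      by (intro LIMSEQ_le_const2[OF _ exI[of _ m]]) blast+
    then show "(1 + real m) ^ k * norm (u m) \<le> suminf w"
      by simp
  qed
qed

text \<open>
  Eventually each increment is within \<open>norm D / 2\<close> of \<open>D\<close>, so over \<open>p\<close> steps the sequence drifts by at
  least \<open>p * norm D / 2\<close>, which exceeds the diameter \<open>2 * B\<close> of its range when \<open>p\<close> is large and
  \<open>D \<noteq> 0\<close>.
\<close>

lemma bounded_increments_limit_eq_0:
  fixes v :: "nat \<Rightarrow> complex"
  assumes B: "\<And>m. norm (v m) \<le> B" and lim: "(\<lambda>m. v (Suc m) - v m) \<longlonglongrightarrow> D"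
  shows "D = 0"
proof (rule ccontr)
  assume "D \<noteq> 0"
  then obtain M where M: "\<And>m. m \<ge> M \<Longrightarrow> norm (v (Suc m) - v m - D) < norm D / 2"
    using LIMSEQ_D[OF lim, of "norm D / 2"] by auto
  have drift: "norm (v (M + p) - v M - of_nat p * D) \<le> real p * (norm D / 2)" for p
  proof (induction p)
    case (Suc p)
    have "v (M + Suc p) - v M - of_nat (Suc p) * D
        = (v (M + p) - v M - of_nat p * D) + (v (Suc (M + p)) - v (M + p) - D)"
      by (simp add: algebra_simps)
    also have "norm \<dots> \<le> real p * (norm D / 2) + norm D / 2"
      using Suc M[of "M + p"] by (intro norm_triangle_le) auto
    finally show ?case
      by (simp add: field_simps)
  qed simp
  obtain p where p: "4 * B < real p * norm D"
    using ex_less_of_nat_mult[of "norm D" "4 * B"] \<open>D \<noteq> 0\<close> by auto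
  have "norm (of_nat p * D) \<le> norm (v (M + p) - v M) + norm (v (M + p) - v M - of_nat p * D)"
    by norm
  also have "norm (v (M + p) - v M) \<le> B + B"
    by (intro norm_triangle_le_diff add_mono B)
  finally show False
    using drift[of p] p by (simp add: norm_mult)
qed

text \<open>
  The three sequences are the right halves of consecutive rows. The factor \<open>\<i> ^ m\<close> turns the solution
  \<open>(- \<i>) ^ m\<close> of the homogeneous recurrence into a constant, so that the left-hand sides become
  increments and the possible obstruction to rapid decrease becomes a limit.
\<close>

lemma rapid_next_row:
  fixes f g h :: "nat \<Rightarrow> complex"
  assumes fg: "\<And>m. g (Suc m) + \<i> * g m = f m + \<i> * f (Suc m)"
    and gh: "\<And>m. h (Suc m) + \<i> * h m = g m + \<i> * g (Suc m)"
    and f: "rapid f" and B: "\<And>m. norm (h m) \<le> B"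
  shows "rapid g"
proof -
  define u where "u = (\<lambda>m. \<i> ^ m * g m)"
  define v where "v = (\<lambda>m. \<i> ^ m * h m)"
  have gauge: "\<i> ^ Suc m * x (Suc m) - \<i> ^ m * x m = \<i> ^ Suc m * (x (Suc m) + \<i> * x m)"
    for x :: "nat \<Rightarrow> complex" and m
    by (simp add: algebra_simps)
  have "u (Suc m) - u m = \<i> ^ Suc m * (f m + \<i> * f (Suc m))" for m
    unfolding u_def gauge fg ..
  then have d: "rapid (\<lambda>m. u (Suc m) - u m)"
    using rapid_step[OF f] by (simp add: rapid_def norm_mult norm_power)
  then obtain L where L: "u \<longlonglongrightarrow> L"
    using rapid_increments_imp_convergent convergent_def by blast
  have "L = 0"
  proof -
    have v_inc: "v (Suc m) - v m = \<i> * u m + \<i> * u (Suc m)" for m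
      unfolding v_def gauge gh unfolding u_def by (simp add: algebra_simps)
    have "(\<lambda>m. v (Suc m) - v m) \<longlonglongrightarrow> \<i> * L + \<i> * L"
      unfolding v_inc by (intro tendsto_intros L LIMSEQ_Suc)
    moreover have "norm (v m) \<le> B" for m
      using B by (simp add: v_def norm_mult norm_power)
    ultimately have "\<i> * L + \<i> * L = 0"
      by (intro bounded_increments_limit_eq_0)
    then show ?thesis
      by simp
  qed
  with L have "rapid u"
    using rapid_if_rapid_increments[OF d] by simp
  then show ?thesis
    by (simp add: rapid_def u_def norm_mult norm_power)
qed

lemma rapid_rows_above:
  assumes F: "discrete_entire F" and B: "\<And>n. \<exists>B. \<forall>m. norm (F (m, n)) \<le> B"
    and 0: "rapid (\<lambda>m. F (int m, 0))"
  shows "rapid (\<lambda>m. F (int m, int n))"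
proof (induction n)
  case (Suc n)
  have rec: "F (int (Suc m), b + 1) + \<i> * F (int m, b + 1) = F (int m, b) + \<i> * F (int (Suc m), b)"
    for m b
    using F[unfolded discrete_entire_def, rule_format, of "int m" b]
    by (simp add: algebra_simps)
  obtain B' where B': "\<And>m. norm (F (m, int n + 1 + 1)) \<le> B'"
    using B by blast
  have "rapid (\<lambda>m. F (int m, int n + 1))"
    by (rule rapid_next_row[where f = "\<lambda>m. F (int m, int n)" and h = "\<lambda>m. F (int m, int n + 1 + 1)",
          OF rec rec Suc B'])
  then show ?case
    by (simp add: add.commute)
qed (use 0 in simp)

lemma discrete_entire_point_reflection:
  assumes "discrete_entire F"
  shows "discrete_entire (\<lambda>(m, n). F (- m, - n))"
  unfolding discrete_entire_def
proof (intro allI)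
  fix m n
  have "F (- m, - n) - F (- m - 1, - n - 1) = - \<i> * (F (- m - 1, - n) - F (- m, - n - 1))"
    using assms[unfolded discrete_entire_def, rule_format, of "- m - 1" "- n - 1"] by simp
  then have "F (- m - 1, - n - 1) - F (- m, - n) = - \<i> * (F (- m, - n - 1) - F (- m - 1, - n))"
    by (metis minus_diff_eq mult_minus_right)
  then show "(case (m + 1, n + 1) of (m, n) \<Rightarrow> F (- m, - n)) - (case (m, n) of (m, n) \<Rightarrow> F (- m, - n)) =
    - \<i> * ((case (m, n + 1) of (m, n) \<Rightarrow> F (- m, - n)) - (case (m + 1, n) of (m, n) \<Rightarrow> F (- m, - n)))"
    by simp
qed

text \<open>
  Reflecting only \<open>m\<close> turns the recurrence into the one with \<open>- \<i>\<close> in place of \<open>\<i>\<close>; conjugation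
  undoes this.
\<close>

lemma discrete_entire_cnj_reflection:
  assumes "discrete_entire F"
  shows "discrete_entire (\<lambda>(m, n). cnj (F (- m, n)))"
  unfolding discrete_entire_def
proof (intro allI)
  fix m n
  have "F (- m, n + 1) - F (- m - 1, n) = - \<i> * (F (- m - 1, n + 1) - F (- m, n))"
    using assms[unfolded discrete_entire_def, rule_format, of "- m - 1" n] by simp
  then have "F (- m - 1, n + 1) - F (- m, n) = \<i> * (F (- m, n + 1) - F (- m - 1, n))"
    by simp
  from arg_cong[OF this, of cnj]
  show "(case (m + 1, n + 1) of (m, n) \<Rightarrow> cnj (F (- m, n))) - (case (m, n) of (m, n) \<Rightarrow> cnj (F (- m, n))) =
    - \<i> * ((case (m, n + 1) of (m, n) \<Rightarrow> cnj (F (- m, n))) - (case (m + 1, n) of (m, n) \<Rightarrow> cnj (F (- m, n))))"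
    by simp
qed

lemma summable_on_int_if_rapid:
  fixes f :: "int \<Rightarrow> complex"
  assumes "rapid (\<lambda>m. f (int m))" and "rapid (\<lambda>m. f (- int m))"
  shows "(\<lambda>m. norm (f m)) summable_on UNIV"
proof -
  have half: "(\<lambda>m. norm (f m)) summable_on range g" if "rapid (\<lambda>m. f (g m))" "inj g"
    for g :: "nat \<Rightarrow> int"
  proof -
    have "summable (\<lambda>m. norm (f (g m)))"
      using rapid_imp_weighted_summable[OF that(1), of 0] by simp
    then have "(\<lambda>m. norm (f (g m))) summable_on UNIV"
      by (simp add: summable_on_UNIV_nonneg_real_iff)
    then show ?thesis
      using that(2) by (simp add: summable_on_reindex o_def)
  qed
  have pos: "(\<lambda>m. norm (f m)) summable_on range int"
    by (rule half[OF assms(1)]) simp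
  have neg: "(\<lambda>m. norm (f m)) summable_on range (\<lambda>m. - int m)"
    by (rule half[OF assms(2)]) (simp add: inj_def)
  \<comment> \<open>Both ranges contain \<open>0\<close>, so it is removed from one of them.\<close>
  have "(\<lambda>m. norm (f m)) summable_on (range int \<union> (range (\<lambda>m. - int m) - range int))"
    by (intro summable_on_Un_disjoint pos summable_on_subset_banach[OF neg]) auto
  also have "range int \<union> (range (\<lambda>m. - int m) - range int) = UNIV"
    by (auto intro: int_cases2)
  finally show ?thesis .
qed

lemma rows_summable_above:
  assumes F: "discrete_entire F" and B: "\<And>n. \<exists>B. \<forall>m. norm (F (m, n)) \<le> B"
    and pos: "rapid (\<lambda>m. F (int m, 0))" and neg: "rapid (\<lambda>m. F (- int m, 0))"
  shows "(\<lambda>m. norm (F (m, int n))) summable_on UNIV"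
proof (rule summable_on_int_if_rapid)
  show "rapid (\<lambda>m. F (int m, int n))"
    by (rule rapid_rows_above[OF F B pos])
  have "rapid (\<lambda>m. case (int m, int n) of (m, n) \<Rightarrow> cnj (F (- m, n)))"
  proof (rule rapid_rows_above[OF discrete_entire_cnj_reflection[OF F]])
    show "\<exists>B. \<forall>m. norm (case (m, n) of (m, n) \<Rightarrow> cnj (F (- m, n))) \<le> B" for n
      using B[of n] by auto
    show "rapid (\<lambda>m. case (int m, 0) of (m, n) \<Rightarrow> cnj (F (- m, n)))"
      using neg by (simp add: rapid_def)
  qed
  then show "rapid (\<lambda>m. F (- int m, int n))"
    by (simp add: rapid_def)
qed

theorem theorem1p6:
  fixes \<alpha> :: real and F :: "int \<times> int \<Rightarrow> complex"
  assumes "0 < \<alpha>" and "\<alpha> < pi / 2"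
    and "F \<in> PW \<alpha>"
    and "\<forall>k::nat. \<exists>c::real. \<forall>m::int.
           norm (F (m, 0)) \<le> c * (1 + \<bar>real_of_int m\<bar>) powi (- int k)"
  shows "\<forall>n::int. (\<lambda>m::int. norm (F (m, n))) summable_on UNIV"
proof
  fix n :: int
  have F: "discrete_entire F"
    using assms(3) by (simp add: PW_def)
  have B: "\<exists>B. \<forall>m. norm (F (m, n)) \<le> B" for n
    using assms(3) unfolding PW_def by blast
  have decay: "\<exists>c. \<forall>m. (1 + \<bar>real_of_int m\<bar>) ^ k * norm (F (m, 0)) \<le> c" for k
  proof -
    obtain c where c: "\<And>m. norm (F (m, 0)) \<le> c * (1 + \<bar>real_of_int m\<bar>) powi (- int k)"
      using assms(4) by blast
    have "(1 + \<bar>real_of_int m\<bar>) ^ k * norm (F (m, 0)) \<le> c" for m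
      using c[of m] by (simp add: power_int_minus field_simps)
    then show ?thesis
      by blast
  qed
  have right: "rapid (\<lambda>m. F (int m, 0))"
    unfolding rapid_def
  proof
    fix k
    show "\<exists>c. \<forall>m. (1 + real m) ^ k * norm (F (int m, 0)) \<le> c"
      using decay[of k] by (metis of_int_of_nat_eq abs_of_nat)
  qed
  have left: "rapid (\<lambda>m. F (- int m, 0))"
    unfolding rapid_def
  proof
    fix k
    show "\<exists>c. \<forall>m. (1 + real m) ^ k * norm (F (- int m, 0)) \<le> c"
      using decay[of k] by (metis of_int_of_nat_eq abs_of_nat of_int_minus abs_minus_cancel)
  qed
  show "(\<lambda>m. norm (F (m, n))) summable_on UNIV"
  proof (cases n)
    case (nonneg k)
    then show ?thesis
      using rows_summable_above[OF F B right left] by simp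
  next
    case (neg k)
    let ?G = "\<lambda>(m, n). F (- m, - n)"
    have "(\<lambda>m. norm (?G (m, int (Suc k)))) summable_on UNIV"
    proof (rule rows_summable_above[OF discrete_entire_point_reflection[OF F]])
      show "\<exists>B. \<forall>m. norm (?G (m, n)) \<le> B" for n
        using B[of "- n"] by auto
    qed (use right left in auto)
    then have "(\<lambda>m. norm (F (m, n))) \<circ> uminus summable_on UNIV"
      using neg by (simp add: o_def)
    then have "(\<lambda>m. norm (F (m, n))) summable_on range uminus"
      by (subst summable_on_reindex) (auto simp: inj_def)
    then show ?thesis
      by simp
  qed
qed

end
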